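(* For every $k\in\mathbb{N}_1$, the set $S_k$ equipped with concatenation is a commutative, cancellative monoid under the equivalence $\simeq$; that is, with $\simeq$ playing the role of equality, concatenation makes $S_k$ a monoid which is commutative ($X\cdot Y\simeq Y\cdot X$) and cancellative ($X\cdot Y\simeq X\cdot Z$ implies $Y\simeq Z$).
   Context: $\mathbb{N}_0$ denotes the non-negative integers and $\mathbb{N}_1$ the positive integers. Let $f:n\mapsto n/2$ (applied only to even $n$) and $g:n\mapsto 3n+1$. The Loosened Collatz graph is the directed graph with vertex set $\mathbb{N}_1$ having an edge $n\to 3n+1$ (the $g$-edge) for every $n\in\mathbb{N}_1$ and an edge $n\to n/2$ (the $f$-edge) for every even $n\in\mathbb{N}_1$. For an $n$-tuple $Y=(y_1,\dots,y_n)$ of non-negative integers, $n\ge1$, put $$F_L(Y)=\frac{\sum_{i=1}^{n}3^{n-i}\cdot 2^{\sum_{j=0}^{i-1}y_j}}{2^{\sum_{i=1}^{n}y_i}-3^n},\qquad y_0=0.$$ For $k\in\mathbb{N}_1$, let $S_k=\{X=(x_1,\dots,x_n): n\ge 1,\ x_i\in\mathbb{N}_0,\ F_L(X)=k\}\cup\{\emptyset\}$, where $\emptyset$ is the empty tuple. Concatenation is $(x_1,\dots,x_p)\cdot(y_1,\dots,y_q)=(x_1,\dots,x_p,y_1,\dots,y_q)$. A nonempty $X=(x_1,\dots,x_n)\in S_k$ represents the directed circuit (not necessarily simple) in the Loosened Collatz graph that starts at $k$, applies $g$ once, then $f$ $x_1$ times, then $g$ once, then $f$ $x_2$ times, and so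 on, ending with $x_n$ applications of $f$ and returning to $k$; $\emptyset$ represents the empty circuit. For $A,B\in S_k$, write $A\simeq B$ if the circuits represented by $A$ and $B$ have the same unordered sets of edges and vertices, and each edge and each vertex is met the same number of times in both circuits (the start and end of the closed circuit being counted as one visit). *)

theory Defs
  imports Complex_Main "Graph_Theory.Arc_Walk"
begin

definition col_f :: "nat \<Rightarrow> nat" where
  "col_f n = n div 2"

definition col_g :: "nat \<Rightarrow> nat" where
  "col_g n = 3 * n + 1"

text \<open>
  An \<open>f\<close>-edge and a \<open>g\<close>-edge with the same source always have different targets, so an edge
  is determined by its end points.
\<close>

definition loosened_collatz :: "(nat, nat \<times> nat) pre_digraph" where
  "loosened_collatz =
     \<lparr> verts = {n. n \<ge> 1},
       arcs = {(n, col_g n) | n. n \<ge> 1} \<union> {(n, col_f n) | n. n \<ge> 1 \<and> even n},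
       tail = fst, head = snd \<rparr>"

text \<open>
  The list \<open>0 # Y\<close> is indexed from \<open>0\<close>, so that \<open>(0 # Y) ! j\<close> is \<open>y\<^sub>j\<close> with
  the convention \<open>y\<^sub>0 = 0\<close>. For nonempty \<open>Y\<close> the denominator is nonzero, being the difference
  of a power of two and an odd number greater than one.
\<close>

definition F_L :: "nat list \<Rightarrow> rat" where
  "F_L Y = (let n = length Y; y = (\<lambda>j. (0 # Y) ! j) in
     (\<Sum>i=1..n. 3 ^ (n - i) * 2 ^ (\<Sum>j=0..i-1. y j)) / (2 ^ (\<Sum>i=1..n. y i) - 3 ^ n))"

definition S :: "nat \<Rightarrow> nat list set" where
  "S k = {X. X \<noteq> [] \<and> F_L X = of_nat k} \<union> {[]}"

primrec f_steps :: "nat \<Rightarrow> nat \<Rightarrow> (nat \<times> nat) list" where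
  "f_steps 0 n = []"
| "f_steps (Suc x) n = (n, col_f n) # f_steps x (col_f n)"

text \<open>
  The sequence of edges traversed from a given start vertex. The rounding of \<open>div\<close> never takes
  effect for members of \<open>S k\<close>: by \<open>awalk_circuit\<close> below their circuits are closed walks in
  the graph, in which an \<open>f\<close>-edge leaves even numbers only.
\<close>

primrec circuit :: "nat \<Rightarrow> nat list \<Rightarrow> (nat \<times> nat) list" where
  "circuit n [] = []"
| "circuit n (x # xs) =
     (n, col_g n) # f_steps x (col_g n) @ circuit ((col_f ^^ x) (col_g n)) xs"

text \<open>Dropping the first vertex counts the common start and end as one visit.\<close>

definition circuit_verts :: "nat \<Rightarrow> nat list \<Rightarrow> nat list" where
  "circuit_verts k X = tl (pre_digraph.awalk_verts loosened_collatz k (circuit k X))"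

definition circuit_eq :: "nat list \<Rightarrow> nat \<Rightarrow> nat list \<Rightarrow> bool"
    (\<open>(_ \<simeq>\<^bsub>_\<^esub> _)\<close> [51, 0, 51] 50) where
  "A \<simeq>\<^bsub>k\<^esub> B \<longleftrightarrow>
     set (circuit k A) = set (circuit k B) \<and>
     set (circuit_verts k A) = set (circuit_verts k B) \<and>
     (\<forall>e. count_list (circuit k A) e = count_list (circuit k B) e) \<and>
     (\<forall>v. count_list (circuit_verts k A) v = count_list (circuit_verts k B) v)"

primrec F_num :: "nat list \<Rightarrow> nat" where
  "F_num [] = 0"
| "F_num (x # xs) = 3 ^ length xs + 2 ^ x * F_num xs"

lemma F_num_eq:
  "of_nat (F_num Y) = (\<Sum>i=1..length Y. 3 ^ (length Y - i) * 2 ^ (\<Sum>j=0..i-1. (0 # Y) ! j) :: rat)"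
proof (induction Y)
  case (Cons x xs)
  have shift: "(\<Sum>j=0..Suc i. (0 # x # xs) ! j) = x + (\<Sum>j=0..i. (0 # xs) ! j)" for i
    by (induction i) (simp_all add: nth_Cons')
  have "(\<Sum>i=1..length (x # xs). 3 ^ (length (x # xs) - i) * 2 ^ (\<Sum>j=0..i-1. (0 # x # xs) ! j) :: rat)
      = (\<Sum>i<Suc (length xs). 3 ^ (length xs - i) * 2 ^ (\<Sum>j=0..i. (0 # x # xs) ! j))"
    by (rule sum.reindex_bij_witness[of _ Suc "\<lambda>i. i - 1"]) auto
  also have "\<dots> = 3 ^ length xs
      + (\<Sum>i<length xs. 3 ^ (length xs - Suc i) * 2 ^ (\<Sum>j=0..Suc i. (0 # x # xs) ! j))"
    by (subst sum.lessThan_Suc_shift) simp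
  also have "(\<Sum>i<length xs. 3 ^ (length xs - Suc i) * 2 ^ (\<Sum>j=0..Suc i. (0 # x # xs) ! j) :: rat)
      = 2 ^ x * (\<Sum>i<length xs. 3 ^ (length xs - Suc i) * 2 ^ (\<Sum>j=0..i. (0 # xs) ! j))"
    unfolding shift by (simp add: sum_distrib_left power_add algebra_simps)
  also have "(\<Sum>i<length xs. 3 ^ (length xs - Suc i) * 2 ^ (\<Sum>j=0..i. (0 # xs) ! j) :: rat)
      = (\<Sum>i=1..length xs. 3 ^ (length xs - i) * 2 ^ (\<Sum>j=0..i-1. (0 # xs) ! j))"
    by (rule sum.reindex_bij_witness[of _ "\<lambda>i. i - 1" Suc]) auto
  finally show ?case using Cons.IH by simp
qed simp

lemma sum_nth_Cons: "(\<Sum>i=1..length Y. (0 # Y) ! i) = sum_list Y" for Y :: "nat list"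
proof -
  have "(\<Sum>i=1..length Y. (0 # Y) ! i) = (\<Sum>i<length Y. Y ! i)"
    by (rule sum.reindex_bij_witness[of _ Suc "\<lambda>i. i - 1"]) auto
  then show ?thesis by (simp add: sum_list_sum_nth atLeast0LessThan)
qed

lemma denominator_nonzero:
  assumes "n \<ge> 1" shows "(2 ^ s - 3 ^ n :: rat) \<noteq> 0"
proof
  assume "(2 ^ s - 3 ^ n :: rat) = 0"
  then have "of_nat (2 ^ s) = (of_nat (3 ^ n) :: rat)" by simp
  then have eq: "(2::nat) ^ s = 3 ^ n" using of_nat_eq_iff by blast
  have "odd ((3::nat) ^ n)" by simp
  with eq have "s = 0" by (metis dvd_power even_numeral not_gr_zero)
  moreover have "(1::nat) < 3 ^ n" using assms by (intro one_less_power) simp_all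
  ultimately show False using eq by simp
qed

lemma S_balance:
  assumes "X \<in> S k" shows "k * 3 ^ length X + F_num X = 2 ^ sum_list X * k"
proof (cases "X = []")
  case False
  then have "F_L X = of_nat k" using assms by (simp add: S_def)
  then have "of_nat (F_num X) / (2 ^ sum_list X - 3 ^ length X) = (of_nat k :: rat)"
    unfolding F_L_def Let_def F_num_eq[symmetric] sum_nth_Cons .
  moreover have "(2 ^ sum_list X - 3 ^ length X :: rat) \<noteq> 0"
    using False by (intro denominator_nonzero) (simp add: Suc_leI)
  ultimately have "of_nat (F_num X) = of_nat k * (2 ^ sum_list X - 3 ^ length X :: rat)"
    by (simp add: divide_eq_eq)
  then have "of_nat (k * 3 ^ length X + F_num X) = (of_nat (2 ^ sum_list X * k) :: rat)"
    by (simp add: algebra_simps)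
  then show ?thesis using of_nat_eq_iff by blast
qed simp

lemma f_steps_walk:
  assumes "m \<ge> 1"
  shows "(col_f ^^ x) (2 ^ x * m) = m
    \<and> set (f_steps x (2 ^ x * m)) \<subseteq> arcs loosened_collatz
    \<and> (\<forall>p v. pre_digraph.cas loosened_collatz (2 ^ x * m) (f_steps x (2 ^ x * m) @ p) v
              \<longleftrightarrow> pre_digraph.cas loosened_collatz m p v)"
proof (induction x)
  case (Suc x)
  have f: "col_f (2 ^ Suc x * m) = 2 ^ x * m" by (simp add: col_f_def)
  have "(col_f ^^ Suc x) (2 ^ Suc x * m) = (col_f ^^ x) (2 ^ x * m)"
    using f by (metis comp_apply funpow_Suc_right)
  moreover have "f_steps (Suc x) (2 ^ Suc x * m)
      = (2 ^ Suc x * m, 2 ^ x * m) # f_steps x (2 ^ x * m)"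
    unfolding f_steps.simps(2) f ..
  moreover have "(2 ^ Suc x * m, 2 ^ x * m) \<in> arcs loosened_collatz"
  proof -
    have "2 ^ Suc x * m \<ge> 1" "even (2 ^ Suc x * m)" using assms by simp_all
    then show ?thesis unfolding f[symmetric] loosened_collatz_def by auto
  qed
  moreover have "tail loosened_collatz = fst" "head loosened_collatz = snd"
    by (simp_all add: loosened_collatz_def)
  ultimately show ?case using Suc.IH by (simp add: pre_digraph.cas.simps del: power_Suc)
qed simp

lemma walk_of_balance:
  assumes "m \<ge> 1" and "m * 3 ^ length X + F_num X = 2 ^ sum_list X * k"
  shows "pre_digraph.awalk loosened_collatz m (circuit m X) k"
  using assms
proof (induction X arbitrary: m)
  case Nil
  then show ?case
    by (simp add: pre_digraph.awalk_def pre_digraph.cas.simps loosened_collatz_def)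
next
  case (Cons x xs)
  have eq: "3 ^ length xs * (3 * m + 1) + 2 ^ x * F_num xs = 2 ^ x * (2 ^ sum_list xs * k)"
    using Cons.prems(2) by (simp add: power_add algebra_simps)
  then have "2 ^ x dvd 3 ^ length xs * (3 * m + 1)"
    by (metis dvd_add_left_iff dvd_triv_left)
  moreover have "coprime ((2::nat) ^ x) (3 ^ length xs)"
    by (simp add: coprime_commute)
  ultimately have "2 ^ x dvd 3 * m + 1"
    using coprime_dvd_mult_right_iff by blast
  then obtain m' where m': "3 * m + 1 = 2 ^ x * m'" by (elim dvdE)
  then have pos: "m' \<ge> 1" by (cases m') auto
  have "2 ^ x * (m' * 3 ^ length xs + F_num xs) = 2 ^ x * (2 ^ sum_list xs * k)"
    using eq unfolding m' by (simp add: algebra_simps)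
  then have IH: "pre_digraph.awalk loosened_collatz m' (circuit m' xs) k"
    using Cons.IH[OF pos] by simp
  have g: "col_g m = 2 ^ x * m'" using m' by (simp add: col_g_def)
  have "(m, col_g m) \<in> arcs loosened_collatz"
    using Cons.prems(1) by (auto simp: loosened_collatz_def)
  then show ?case
    using f_steps_walk[OF pos, of x] IH Cons.prems(1)
    by (simp add: g pre_digraph.awalk_def pre_digraph.cas.simps loosened_collatz_def)
qed

lemma awalk_circuit:
  assumes "k \<ge> 1" and "X \<in> S k"
  shows "pre_digraph.awalk loosened_collatz k (circuit k X) k"
  using assms S_balance walk_of_balance by blast

end

theory Submission
  imports Defs "HOL-Library.Multiset"
begin

text \<open>
  Each member of \<open>S k\<close> labels a closed walk at \<open>k\<close>, so the circuit of a concatenation is the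
  circuit of the first factor followed by the circuit of the second (\<open>circuit_append\<close>): the
  second factor starts where the first one ended, at \<open>k\<close> again. The visited vertices are the
  heads of the traversed edges, so all four conditions in the definition of \<open>\<simeq>\<close> amount to the one
  condition that the two circuits have the same multiset of edges (\<open>circuit_eq_iff_mset\<close>).
  Hence \<open>X \<mapsto> mset (circuit k X)\<close> turns concatenation into the sum of multisets and has \<open>\<simeq>\<close> as
  its kernel, and \<open>S k\<close> modulo \<open>\<simeq>\<close> inherits commutativity and cancellation from multisets.

  Closure under concatenation is arithmetic. The equation \<open>F\<^sub>L X = k\<close>, cleared of its
  denominator, says that \<open>k\<close> is a fixed point of the affine map
  \<open>t \<mapsto> (3\<^sup>n t + F_num X) / 2\<^sup>s\<close>, where \<open>n\<close> is the length and \<open>s\<close> the sum of \<open>X\<close>.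
  Concatenation composes these maps (\<open>F_num_append\<close>), and a common fixed point of two maps is
  fixed by their composition.
\<close>

lemma F_num_append: "F_num (X @ Y) = 3 ^ length Y * F_num X + 2 ^ sum_list X * F_num Y"
  by (induction X) (simp_all add: power_add algebra_simps)

text \<open>
  The denominator of \<open>F_L\<close> vanishes only for the empty tuple, which belongs to \<open>S k\<close> by
  definition, so \<open>S_balance\<close> can be reversed.
\<close>

lemma S_iff_balance: "X \<in> S k \<longleftrightarrow> k * 3 ^ length X + F_num X = 2 ^ sum_list X * k"
proof
  assume balance: "k * 3 ^ length X + F_num X = 2 ^ sum_list X * k"
  show "X \<in> S k"
  proof (cases "X = []")
    case False
    have "of_nat (k * 3 ^ length X + F_num X) = (of_nat (2 ^ sum_list X * k) :: rat)"
      using balance by simp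
    then have "of_nat (F_num X) = of_nat k * (2 ^ sum_list X - 3 ^ length X :: rat)"
      by (simp add: algebra_simps)
    moreover have "(2 ^ sum_list X - 3 ^ length X :: rat) \<noteq> 0"
      using False by (intro denominator_nonzero) (simp add: Suc_leI)
    ultimately have "of_nat (F_num X) / (2 ^ sum_list X - 3 ^ length X) = (of_nat k :: rat)"
      by (simp add: divide_eq_eq)
    then have "F_L X = of_nat k"
      unfolding F_L_def Let_def F_num_eq[symmetric] sum_nth_Cons .
    with False show ?thesis by (simp add: S_def)
  qed (simp add: S_def)
qed (rule S_balance)

lemma append_in_S:
  assumes "X \<in> S k" and "Y \<in> S k"
  shows "X @ Y \<in> S k"
proof -
  have X: "k * 3 ^ length X + F_num X = 2 ^ sum_list X * k"
    and Y: "k * 3 ^ length Y + F_num Y = 2 ^ sum_list Y * k"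
    using assms by (simp_all only: S_iff_balance)
  have "k * 3 ^ length (X @ Y) + F_num (X @ Y)
      = 3 ^ length Y * (k * 3 ^ length X + F_num X) + 2 ^ sum_list X * F_num Y"
    by (simp add: F_num_append power_add algebra_simps)
  also have "\<dots> = 2 ^ sum_list X * (k * 3 ^ length Y + F_num Y)"
    unfolding X by (simp add: algebra_simps)
  also have "\<dots> = 2 ^ sum_list (X @ Y) * k"
    unfolding Y by (simp add: power_add)
  finally show ?thesis by (simp only: S_iff_balance)
qed

lemma cas_f_steps_append:
  "pre_digraph.cas loosened_collatz n (f_steps x n @ p) v
    \<longleftrightarrow> pre_digraph.cas loosened_collatz ((col_f ^^ x) n) p v"
  by (induction x arbitrary: n)
    (simp_all add: pre_digraph.cas.simps loosened_collatz_def funpow_swap1)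

lemma circuit_append:
  assumes "pre_digraph.cas loosened_collatz n (circuit n X) m"
  shows "circuit n (X @ Y) = circuit n X @ circuit m Y"
  using assms
proof (induction X arbitrary: n)
  case Nil
  then show ?case by (simp add: pre_digraph.cas.simps)
next
  case (Cons x X)
  then have "pre_digraph.cas loosened_collatz (col_g n)
      (f_steps x (col_g n) @ circuit ((col_f ^^ x) (col_g n)) X) m"
    by (simp add: pre_digraph.cas.simps loosened_collatz_def)
  then show ?case using Cons.IH by (simp add: cas_f_steps_append)
qed

lemma tl_awalk_verts_eq_heads:
  assumes "pre_digraph.cas G u p v"
  shows "tl (pre_digraph.awalk_verts G u p) = map (head G) p"
proof -
  have "pre_digraph.awalk_verts G u p = u # map (head G) p"
    using assms
    by (induction p arbitrary: u)
      (auto simp: pre_digraph.cas.simps pre_digraph.awalk_verts.simps)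
  then show ?thesis by simp
qed

lemma cas_circuit:
  assumes "k \<ge> 1" and "X \<in> S k"
  shows "pre_digraph.cas loosened_collatz k (circuit k X) k"
  using awalk_circuit[OF assms] by (simp add: pre_digraph.awalk_def)

lemma mset_circuit_append:
  assumes "k \<ge> 1" and "X \<in> S k"
  shows "mset (circuit k (X @ Y)) = mset (circuit k X) + mset (circuit k Y)"
  by (simp add: circuit_append[OF cas_circuit[OF assms]])

text \<open>
  The underlying sets are determined by the multiplicities, and the vertex multiplicities by the
  edge multiplicities, since the visited vertices are the heads of the traversed edges.
\<close>

lemma circuit_eq_iff_mset:
  assumes "k \<ge> 1" and "X \<in> S k" and "Y \<in> S k"
  shows "X \<simeq>\<^bsub>k\<^esub> Y \<longleftrightarrow> mset (circuit k X) = mset (circuit k Y)"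
proof -
  have verts: "mset (circuit_verts k Z) = image_mset snd (mset (circuit k Z))" if "Z \<in> S k" for Z
    using tl_awalk_verts_eq_heads[OF cas_circuit[OF \<open>k \<ge> 1\<close> that]]
    by (simp add: circuit_verts_def loosened_collatz_def)
  have counts: "(\<forall>a. count_list p a = count_list q a) \<longleftrightarrow> mset p = mset q" for p q :: "'a list"
    by (simp add: multiset_eq_iff count_mset)
  show ?thesis
    unfolding circuit_eq_def counts
    using verts[OF assms(2)] verts[OF assms(3)] by (metis mset_eq_setD)
qed

theorem theorem4:
  fixes k :: nat
  assumes "k \<ge> 1"
  shows
    "equiv (S k) {(X, Y). X \<in> S k \<and> Y \<in> S k \<and> X \<simeq>\<^bsub>k\<^esub> Y} \<and>
     (\<forall>X\<in>S k. \<forall>Y\<in>S k. X @ Y \<in> S k) \<and>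
     (\<forall>X\<in>S k. \<forall>X'\<in>S k. \<forall>Y\<in>S k. \<forall>Y'\<in>S k.
        X \<simeq>\<^bsub>k\<^esub> X' \<longrightarrow> Y \<simeq>\<^bsub>k\<^esub> Y' \<longrightarrow> X @ Y \<simeq>\<^bsub>k\<^esub> X' @ Y') \<and>
     (\<forall>X\<in>S k. \<forall>Y\<in>S k. \<forall>Z\<in>S k. (X @ Y) @ Z \<simeq>\<^bsub>k\<^esub> X @ (Y @ Z)) \<and>
     ([] \<in> S k \<and> (\<forall>X\<in>S k. [] @ X \<simeq>\<^bsub>k\<^esub> X \<and> X @ [] \<simeq>\<^bsub>k\<^esub> X)) \<and>
     (\<forall>X\<in>S k. \<forall>Y\<in>S k. X @ Y \<simeq>\<^bsub>k\<^esub> Y @ X) \<and>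
     (\<forall>X\<in>S k. \<forall>Y\<in>S k. \<forall>Z\<in>S k. X @ Y \<simeq>\<^bsub>k\<^esub> X @ Z \<longrightarrow> Y \<simeq>\<^bsub>k\<^esub> Z)"
proof -
  have kernel: "X \<simeq>\<^bsub>k\<^esub> Y \<longleftrightarrow> mset (circuit k X) = mset (circuit k Y)"
    if "X \<in> S k" "Y \<in> S k" for X Y
    using circuit_eq_iff_mset[OF assms that] .
  have additive: "mset (circuit k (X @ Y)) = mset (circuit k X) + mset (circuit k Y)"
    if "X \<in> S k" for X Y
    using mset_circuit_append[OF assms that] .
  have "equiv (S k) {(X, Y). X \<in> S k \<and> Y \<in> S k \<and> X \<simeq>\<^bsub>k\<^esub> Y}"
    by (rule equivI) (auto simp: refl_on_def sym_def trans_def kernel)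
  moreover have "[] \<in> S k"
    by (simp add: S_def)
  ultimately show ?thesis
    by (simp add: kernel additive append_in_S)
qed

end
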